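(* Let $H>0$ and let $B>0$ with $B\neq 1$. Then the surface of revolution in $\mathbb E^3$ with nonzero constant mean curvature $H$, $$S(s,\theta)=(x(s),\;y(s)\cos\theta,\;y(s)\sin\theta),\qquad s\in\mathbb R,\ \theta\in(0,2\pi),$$ whose generating curve is $$x(s)=\int_0^s\frac{1+B\sin 2Ht}{\sqrt{1+B^2+2B\sin 2Ht}}\,dt,\qquad y(s)=\frac{1}{2H}\sqrt{1+B^2+2B\sin 2Hs},$$ is not algebraic. That is, neither the unduloids ($0<B<1$) nor the nodoids ($B>1$) are algebraic.
   Context: $\mathbb E^3$ denotes Euclidean space $(\mathbb R^3,\,dx^2+dy^2+dz^2)$. For $B>0$, $B\neq1$, the quantity $1+B^2+2B\sin 2Hs$ is positive for all $s\in\mathbb R$, so the generating curve is defined on all of $\mathbb R$ with $y(s)>0$. The surface is called an unduloid if $0<B<1$ and a nodoid if $B>1$ (nodoids have self-intersections). A surface in $\mathbb R^3$ is called algebraic if it is given by the vanishing of a polynomial. For parametrized pieces of surfaces this means: there is a nonzero polynomial $P\in\mathbb R[x,y,z]$ such that the surface is contained in (is part of) the zero set $P^{-1}(0)=\{(x,y,z)\in\mathbb R^3: P(x,y,z)=0\}$. *)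

theory Defs
  imports "HOL-Analysis.Analysis" "HOL-Computational_Algebra.Polynomial"
begin

text \<open>
  The ring of real polynomials in three variables is taken as the iterated polynomial ring
  \<open>\<real>[x][y][z]\<close>, i.e. the innermost variable is \<open>x\<close> and the outermost one is \<open>z\<close>.
\<close>

type_synonym poly3 = "real poly poly poly"

definition poly3_eval :: "poly3 \<Rightarrow> real ^ 3 \<Rightarrow> real" where
  "poly3_eval P p = poly (poly (poly P [:[:p $ 3:]:]) [:p $ 2:]) (p $ 1)"

lemma poly3_eval_add: "poly3_eval (P + Q) p = poly3_eval P p + poly3_eval Q p"
  by (simp add: poly3_eval_def)

lemma poly3_eval_monom:
  "poly3_eval (monom (monom (monom c i) j) k) p = c * p $ 1 ^ i * p $ 2 ^ j * p $ 3 ^ k"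
  by (simp add: poly3_eval_def poly_monom poly_power)

definition zero_set :: "poly3 \<Rightarrow> (real ^ 3) set" where
  "zero_set P = {p. poly3_eval P p = 0}"

text \<open>
  For a (parametrized piece of a) surface, ``algebraic'' means being \<^emph>\<open>part of\<close> the zero set of a
  nonzero polynomial, hence inclusion rather than equality.
\<close>

definition algebraic_surface :: "(real ^ 3) set \<Rightarrow> bool" where
  "algebraic_surface S \<longleftrightarrow> (\<exists>P :: poly3. P \<noteq> 0 \<and> S \<subseteq> zero_set P)"

text \<open>
  The interval integral is oriented, so \<open>gen_x H B s\<close> is minus the integral over \<open>[s, 0]\<close>
  when \<open>s < 0\<close>.
\<close>

definition gen_x :: "real \<Rightarrow> real \<Rightarrow> real \<Rightarrow> real" where
  "gen_x H B s =
     (LBINT t=0..s. (1 + B * sin (2 * H * t)) / sqrt (1 + B\<^sup>2 + 2 * B * sin (2 * H * t)))"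

definition gen_y :: "real \<Rightarrow> real \<Rightarrow> real \<Rightarrow> real" where
  "gen_y H B s = 1 / (2 * H) * sqrt (1 + B\<^sup>2 + 2 * B * sin (2 * H * s))"

definition rev_surface :: "real \<Rightarrow> real \<Rightarrow> real \<Rightarrow> real \<Rightarrow> real ^ 3" where
  "rev_surface H B s \<theta> = vector [gen_x H B s, gen_y H B s * cos \<theta>, gen_y H B s * sin \<theta>]"

end

theory Submission imports Defs begin

text \<open>
  The surface is periodic along its axis: the profile radius \<open>gen_y\<close> has period
  \<open>p = pi / H\<close>, and over one period \<open>gen_x\<close> advances by a constant \<open>L\<close>. The crux is
  \<open>L > 0\<close> (\<open>gen_x_advance_pos\<close>). For \<open>B < 1\<close> this is clear since the integrand is positive;
  for \<open>B > 1\<close> the curve runs backwards on part of each period. For all \<open>B\<close> one can pair the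
  parameters \<open>s\<close> and \<open>s + p / 2\<close>, at which the sine takes opposite values. The sum of the two paired speeds is
  nonnegative, and positive at \<open>s = 0\<close> (\<open>paired_speed_nonneg\<close>).

  Hence every line parallel to the axis that meets the surface meets it in infinitely many points,
  so a polynomial vanishing on the surface vanishes identically on each such line. These lines pass
  through the points \<open>(y, z)\<close> of an annulus (apart from one ray), which contains infinitely
  many points on each of infinitely many horizontal lines \<open>z = const\<close>. A nonzero polynomial
  cannot vanish on such a set (\<open>poly3_eq_0_if_vanishes_on_infinite_fibres\<close>).
\<close>

section \<open>Vanishing of polynomials in three variables\<close>

lemma poly_eq_0_if_infinite_roots:
  fixes q :: "'a::idom poly"
  assumes "infinite A" and "inj f" and "\<And>a. a \<in> A \<Longrightarrow> poly q (f a) = 0"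
  shows "q = 0"
proof (rule ccontr)
  assume "q \<noteq> 0"
  then have "finite {x. poly q x = 0}"
    by (rule poly_roots_finite)
  moreover have "f ` A \<subseteq> {x. poly q x = 0}"
    using assms(3) by auto
  ultimately have "finite (f ` A)"
    by (rule rev_finite_subset)
  then show False
    using assms(1,2) by (meson finite_imageD inj_on_subset subset_UNIV)
qed

text \<open>
  One variable is eliminated at a time: at each stage the polynomial, read in the outermost
  remaining variable over an integral domain, has infinitely many constant roots.
\<close>

lemma poly3_eq_0_if_vanishes_on_infinite_fibres:
  fixes P :: poly3
  assumes Z: "infinite Z"
    and Y: "\<And>z. z \<in> Z \<Longrightarrow> infinite (Y z)"
    and X: "\<And>z y. z \<in> Z \<Longrightarrow> y \<in> Y z \<Longrightarrow> infinite {x. poly3_eval P (vector [x, y, z]) = 0}"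
  shows "P = 0"
proof (rule poly_eq_0_if_infinite_roots[OF Z, where f = "\<lambda>z. [:[:z:]:]"])
  show "inj (\<lambda>z::real. [:[:z:]:])"
    by (auto intro: injI)
next
  fix z assume z: "z \<in> Z"
  show "poly P [:[:z:]:] = 0"
  proof (rule poly_eq_0_if_infinite_roots[OF Y[OF z], where f = "\<lambda>y. [:y:]"])
    show "inj (\<lambda>y::real. [:y:])"
      by (auto intro: injI)
  next
    fix y assume y: "y \<in> Y z"
    show "poly (poly P [:[:z:]:]) [:y:] = 0"
      by (rule poly_eq_0_if_infinite_roots[OF X[OF z y], where f = "\<lambda>x. x"])
        (auto simp: poly3_eval_def)
  qed
qed

section \<open>The generating curve\<close>

lemma radicand_pos:
  fixes B c :: real
  assumes "B > 0" "B \<noteq> 1" "\<bar>c\<bar> \<le> 1"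
  shows "1 + B\<^sup>2 + 2 * B * c > 0"
proof -
  have "2 * B * c \<ge> 2 * B * (-1)"
    using assms by (intro mult_left_mono) auto
  moreover have "(1 - B)\<^sup>2 > 0"
    using assms by simp
  ultimately show ?thesis
    by (simp add: power2_eq_square algebra_simps)
qed

text \<open>
  The integrand of \<open>gen_x\<close> as a function of the value \<open>c\<close> of the sine; this isolates the
  symmetry \<open>c \<mapsto> - c\<close>, on which the sign of the advance depends.
\<close>

definition axial_speed :: "real \<Rightarrow> real \<Rightarrow> real" where
  "axial_speed B c = (1 + B * c) / sqrt (1 + B\<^sup>2 + 2 * B * c)"

text \<open>
  With \<open>t = B * c \<ge> 0\<close> and \<open>A = 1 + B\<^sup>2\<close>, the only case in need of an argument is \<open>t > 1\<close>,
  where the claim is \<open>(t - 1) / sqrt (A - 2 * t) \<le> (1 + t) / sqrt (A + 2 * t)\<close>. After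
  squaring and clearing denominators, the right side exceeds the left one by
  \<open>4 * t * (B\<^sup>2 - t\<^sup>2)\<close>, which is nonnegative because \<open>t \<le> B\<close>.
\<close>

lemma paired_speed_nonneg_if_nonneg:
  fixes B c :: real
  assumes B: "B > 0" "B \<noteq> 1" and c: "0 \<le> c" "c \<le> 1"
  shows "axial_speed B c + axial_speed B (- c) \<ge> 0"
proof -
  define t where "t = B * c"
  define A where "A = 1 + B\<^sup>2"
  have t: "0 \<le> t" "t \<le> B"
    using B c by (auto simp: t_def mult_left_le)
  have pos: "A + 2 * t > 0" "A - 2 * t > 0"
    using radicand_pos[OF B, of c] radicand_pos[OF B, of "- c"] c
    by (auto simp: A_def t_def algebra_simps)
  have eq: "axial_speed B c + axial_speed B (- c)
      = (1 + t) / sqrt (A + 2 * t) - (t - 1) / sqrt (A - 2 * t)"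
    by (simp add: axial_speed_def A_def t_def algebra_simps diff_divide_distrib)
  have "(t - 1) * sqrt (A + 2 * t) \<le> (1 + t) * sqrt (A - 2 * t)"
  proof (cases "t \<le> 1")
    case True
    then have "(t - 1) * sqrt (A + 2 * t) \<le> 0"
      using pos by (intro mult_nonpos_nonneg) auto
    also have "0 \<le> (1 + t) * sqrt (A - 2 * t)"
      using pos t by auto
    finally show ?thesis .
  next
    case False
    have "t\<^sup>2 \<le> B\<^sup>2"
      using t by (intro power_mono) auto
    then have "4 * t * (B\<^sup>2 - t\<^sup>2) \<ge> 0"
      using t by simp
    then have "(t - 1)\<^sup>2 * (A + 2 * t) \<le> (1 + t)\<^sup>2 * (A - 2 * t)"
      by (simp add: A_def power2_eq_square algebra_simps)
    then have "((t - 1) * sqrt (A + 2 * t))\<^sup>2 \<le> ((1 + t) * sqrt (A - 2 * t))\<^sup>2"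
      using pos by (simp add: power_mult_distrib)
    then show ?thesis
      by (rule power2_le_imp_le) (use pos t in auto)
  qed
  then have "(t - 1) / sqrt (A - 2 * t) \<le> (1 + t) / sqrt (A + 2 * t)"
    using pos by (simp add: divide_simps)
  then show ?thesis
    using eq by simp
qed

lemma paired_speed_nonneg:
  fixes B c :: real
  assumes B: "B > 0" "B \<noteq> 1" and c: "\<bar>c\<bar> \<le> 1"
  shows "axial_speed B c + axial_speed B (- c) \<ge> 0"
proof (cases "c \<ge> 0")
  case True
  then show ?thesis
    using paired_speed_nonneg_if_nonneg[OF B, of c] c by simp
next
  case False
  then show ?thesis
    using paired_speed_nonneg_if_nonneg[OF B, of "- c"] c by (simp add: add.commute)
qed

lemma gen_x_has_derivative:
  fixes H B s :: real
  assumes B: "B > 0" "B \<noteq> 1"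
  shows "(gen_x H B has_real_derivative axial_speed B (sin (2 * H * s))) (at s)"
proof -
  define a b where "a = min s 0 - 1" and "b = max s 0 + 1"
  define f where "f t = axial_speed B (sin (2 * H * t))" for t
  have rad: "1 + B\<^sup>2 + 2 * B * sin (2 * H * t) \<noteq> 0" for t
    using radicand_pos[OF B, of "sin (2 * H * t)"] by (auto simp: abs_sin_le_one)
  have cont: "continuous_on {a..b} f"
    unfolding f_def axial_speed_def by (intro continuous_intros) (use rad in auto)
  have "((\<lambda>u. LBINT y=ereal 0..u. f y) has_vector_derivative f s) (at s within {a..b})"
    by (rule interval_integral_FTC2[OF _ _ cont]) (auto simp: a_def b_def)
  moreover have "at s within {a..b} = at s"
    by (rule at_within_interior) (auto simp: a_def b_def)
  moreover have "(\<lambda>u. LBINT y=ereal 0..u. f y) = gen_x H B"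
    by (intro ext) (simp add: gen_x_def f_def axial_speed_def zero_ereal_def)
  ultimately show ?thesis
    by (simp add: f_def has_real_derivative_iff_has_vector_derivative)
qed

lemma gen_x_shifted_has_derivative:
  fixes H B s a :: real
  assumes B: "B > 0" "B \<noteq> 1"
  shows "((\<lambda>s. gen_x H B (s + a)) has_real_derivative axial_speed B (sin (2 * H * (s + a)))) (at s)"
  by (rule iffD1[OF DERIV_shift gen_x_has_derivative[OF B]])

lemma sin_half_period:
  fixes H s :: real
  assumes "H > 0"
  shows "sin (2 * H * (s + pi / (2 * H))) = - sin (2 * H * s)"
proof -
  have "2 * H * (s + pi / (2 * H)) = 2 * H * s + pi"
    using assms by (simp add: field_simps)
  then show ?thesis
    by simp
qed

lemma sin_period:
  fixes H s :: real
  assumes "H > 0"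
  shows "sin (2 * H * (s + pi / H)) = sin (2 * H * s)"
proof -
  have "2 * H * (s + pi / H) = 2 * H * s + 2 * pi"
    using assms by (simp add: field_simps)
  then show ?thesis
    by simp
qed

lemma gen_x_advance_constant:
  fixes H B s :: real
  assumes H: "H > 0" and B: "B > 0" "B \<noteq> 1"
  shows "gen_x H B (s + pi / H) = gen_x H B s + (gen_x H B (pi / H) - gen_x H B 0)"
proof -
  have "((\<lambda>s. gen_x H B (s + pi / H) - gen_x H B s) has_real_derivative 0) (at s)" for s
    using DERIV_diff[OF gen_x_shifted_has_derivative[OF B, of H "pi / H" s]
        gen_x_has_derivative[OF B, of H s]]
    by (simp only: sin_period[OF H] diff_self)
  then have "gen_x H B (s + pi / H) - gen_x H B s = gen_x H B (0 + pi / H) - gen_x H B 0"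
    by (intro DERIV_isconst_all) auto
  then show ?thesis
    by simp
qed

text \<open>
  The function \<open>G s = gen_x (s + p / 2) + gen_x s\<close>, with \<open>p = pi / H\<close>, has the paired speed as
  derivative, and its increment over half a period telescopes to the advance of \<open>gen_x\<close> over a
  full period.
\<close>

lemma gen_x_advance_pos:
  fixes H B :: real
  assumes H: "H > 0" and B: "B > 0" "B \<noteq> 1"
  shows "gen_x H B (pi / H) - gen_x H B 0 > 0"
proof -
  define h where "h = pi / (2 * H)"
  define G where "G s = gen_x H B (s + h) + gen_x H B s" for s
  define G' where "G' s = axial_speed B (sin (2 * H * s)) + axial_speed B (- sin (2 * H * s))" for s
  have h: "h > 0"
    using H by (simp add: h_def)
  have G: "(G has_real_derivative G' s) (at s)" for s
    using DERIV_add[OF gen_x_shifted_has_derivative[OF B, of H h s]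
        gen_x_has_derivative[OF B, of H s]] sin_half_period[OF H, of s]
    by (simp add: G_def[abs_def] G'_def h_def add.commute)
  have G'_nonneg: "G' s \<ge> 0" for s
    unfolding G'_def by (rule paired_speed_nonneg[OF B]) (simp add: abs_sin_le_one)
  have "G' 0 > 0"
    by (simp add: G'_def axial_speed_def add_pos_nonneg)
  then obtain d where d: "d > 0" "\<And>e. 0 < e \<Longrightarrow> e < d \<Longrightarrow> G 0 < G (0 + e)"
    using DERIV_pos_inc_right[OF G[of 0]] by auto
  define e where "e = min (d / 2) h"
  have "G 0 < G e"
    using d(2)[of e] d(1) h by (auto simp: e_def)
  also have "G e \<le> G h"
    by (rule DERIV_nonneg_imp_nondecreasing) (use G G'_nonneg in \<open>auto simp: e_def\<close>)
  finally have "gen_x H B 0 < gen_x H B (h + h)"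
    by (simp add: G_def)
  moreover have "h + h = pi / H"
    using H by (simp add: h_def field_simps)
  ultimately show ?thesis
    by simp
qed

lemma gen_x_advance_iterated:
  fixes H B s :: real and n :: nat
  assumes H: "H > 0" and B: "B > 0" "B \<noteq> 1"
  shows "gen_x H B (s + n * (pi / H)) = gen_x H B s + n * (gen_x H B (pi / H) - gen_x H B 0)"
proof (induction n)
  case 0
  then show ?case
    by simp
next
  case (Suc n)
  have "s + Suc n * (pi / H) = s + n * (pi / H) + pi / H"
    by (simp add: algebra_simps add_divide_distrib)
  then show ?case
    using gen_x_advance_constant[OF H B, of "s + n * (pi / H)"] Suc
    by (simp add: algebra_simps)
qed

lemma gen_y_periodic:
  fixes H B s :: real and n :: nat
  assumes H: "H > 0"
  shows "gen_y H B (s + n * (pi / H)) = gen_y H B s"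
proof -
  have "sin (2 * H * (s + n * (pi / H))) = sin (2 * H * s)"
  proof (induction n)
    case 0
    then show ?case
      by simp
  next
    case (Suc n)
    have "s + Suc n * (pi / H) = s + n * (pi / H) + pi / H"
      by (simp add: algebra_simps add_divide_distrib)
    then show ?case
      using sin_period[OF H, of "s + n * (pi / H)"] Suc by (simp only:)
  qed
  then show ?thesis
    by (simp add: gen_y_def)
qed

lemma gen_y_attains:
  fixes H B r :: real
  assumes H: "H > 0" and B: "B > 0" and r: "r > 0"
    and lower: "(1 - B)\<^sup>2 \<le> (2 * H * r)\<^sup>2" and upper: "(2 * H * r)\<^sup>2 \<le> (1 + B)\<^sup>2"
  obtains s where "gen_y H B s = r"
proof
  \<comment> \<open>the value that the sine must take, obtained by solving \<open>gen_y H B s = r\<close>\<close>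
  define c where "c = ((2 * H * r)\<^sup>2 - 1 - B\<^sup>2) / (2 * B)"
  have c: "-1 \<le> c" "c \<le> 1"
    using lower upper B by (auto simp: c_def field_simps power2_eq_square)
  have "sin (2 * H * (arcsin c / (2 * H))) = c"
    using H c by simp
  moreover have "1 + B\<^sup>2 + 2 * B * c = (2 * H * r)\<^sup>2"
    using B by (simp add: c_def)
  ultimately show "gen_y H B (arcsin c / (2 * H)) = r"
    using H r by (simp add: gen_y_def)
qed

section \<open>Lines parallel to the axis\<close>

text \<open>
  The point \<open>(y, z)\<close>, with \<open>z > 0\<close>, has polar angle in \<open>(0, pi)\<close>, and its distance to the
  axis is a value of \<open>gen_y\<close>; this gives one point of the surface on the line, and shifting the
  parameter by multiples of the period gives infinitely many others.
\<close>

lemma line_meets_surface_infinitely_often: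
  fixes H B y z :: real
  assumes H: "H > 0" and B: "B > 0" "B \<noteq> 1" and z: "z > 0"
    and lower: "(1 - B)\<^sup>2 \<le> (2 * H)\<^sup>2 * (y\<^sup>2 + z\<^sup>2)"
    and upper: "(2 * H)\<^sup>2 * (y\<^sup>2 + z\<^sup>2) \<le> (1 + B)\<^sup>2"
  shows "infinite {x. vector [x, y, z] \<in> {rev_surface H B s \<theta> | s \<theta>. s \<in> UNIV \<and> \<theta> \<in> {0<..<2 * pi}}}"
    (is "infinite ?X")
proof -
  define r where "r = sqrt (y\<^sup>2 + z\<^sup>2)"
  have r: "r > 0" and r2: "r\<^sup>2 = y\<^sup>2 + z\<^sup>2"
    using z by (auto simp: r_def add_nonneg_pos)
  obtain s where s: "gen_y H B s = r"
    using gen_y_attains[OF H B(1) r] lower upper r2 by (auto simp: power_mult_distrib)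
  have "(y / r)\<^sup>2 + (z / r)\<^sup>2 = 1"
    unfolding power_divide add_divide_distrib[symmetric] r2[symmetric] using r by simp
  then obtain \<theta> where \<theta>: "0 \<le> \<theta>" "\<theta> \<le> pi" "y / r = cos \<theta>" "z / r = sin \<theta>"
    using sincos_total_pi[of "z / r" "y / r"] z r by auto
  then have yz: "y = r * cos \<theta>" "z = r * sin \<theta>"
    using r by (auto simp: field_simps)
  \<comment> \<open>\<open>z > 0\<close> excludes the endpoint \<open>0\<close>, which is outside the range of the angle\<close>
  have "\<theta> \<noteq> 0"
    using yz(2) z by auto
  then have \<theta>_in: "\<theta> \<in> {0<..<2 * pi}"
    using \<theta> pi_gt_zero by auto
  define L where "L = gen_x H B (pi / H) - gen_x H B 0"
  have "L > 0"
    unfolding L_def by (rule gen_x_advance_pos[OF H B])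
  then have "inj (\<lambda>n::nat. gen_x H B s + n * L)"
    by (auto intro!: injI)
  then have "infinite (range (\<lambda>n::nat. gen_x H B s + n * L))"
    by (rule range_inj_infinite)
  moreover have "gen_x H B s + n * L \<in> ?X" for n :: nat
  proof -
    have "rev_surface H B (s + n * (pi / H)) \<theta> = vector [gen_x H B s + n * L, y, z]"
      by (simp only: rev_surface_def gen_x_advance_iterated[OF H B] gen_y_periodic[OF H] s yz L_def)
    then show ?thesis
      unfolding mem_Collect_eq
      by (intro exI[of _ "s + n * (pi / H)"] exI[of _ \<theta>] conjI UNIV_I \<theta>_in) (rule sym)
  qed
  ultimately show ?thesis
    by (meson finite_subset image_subsetI)
qed

theorem theorem4p3:
  fixes H B :: real
  assumes "H > 0" and "B > 0" and "B \<noteq> 1"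
  shows "\<not> algebraic_surface {rev_surface H B s \<theta> | s \<theta>. s \<in> UNIV \<and> \<theta> \<in> {0<..<2 * pi}}"
proof
  let ?S = "{rev_surface H B s \<theta> | s \<theta>. s \<in> UNIV \<and> \<theta> \<in> {0<..<2 * pi}}"
  note H = assms(1) and B = assms(2,3)
  assume "algebraic_surface ?S"
  then obtain P where P: "P \<noteq> 0" "?S \<subseteq> zero_set P"
    by (auto simp: algebraic_surface_def)
  \<comment> \<open>heights between the least and the greatest radius, so that each horizontal line
    meets the annulus in an interval around \<open>y = 0\<close>, of which the right half is \<open>Y z\<close>\<close>
  define Z where "Z = {\<bar>1 - B\<bar> / (2 * H)<..<(1 + B) / (2 * H)}"
  define Y where "Y z = {0<..<sqrt (((1 + B) / (2 * H))\<^sup>2 - z\<^sup>2)}" for z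
  have "P = 0"
  proof (rule poly3_eq_0_if_vanishes_on_infinite_fibres)
    have "\<bar>1 - B\<bar> < 1 + B"
      using B by auto
    then show "infinite Z"
      using H by (simp add: Z_def divide_strict_right_mono)
  next
    fix z assume "z \<in> Z"
    then have z: "\<bar>1 - B\<bar> / (2 * H) < z" "z < (1 + B) / (2 * H)"
      by (auto simp: Z_def)
    have z0: "z > 0"
      using z(1) H by (smt (verit) divide_nonneg_pos)
    have z2: "z\<^sup>2 < ((1 + B) / (2 * H))\<^sup>2"
      using z z0 by (intro power_strict_mono) auto
    then show "infinite (Y z)"
      by (simp add: Y_def)
    fix y assume "y \<in> Y z"
    then have y: "y > 0" "y < sqrt (((1 + B) / (2 * H))\<^sup>2 - z\<^sup>2)"
      by (auto simp: Y_def)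
    have "y\<^sup>2 < (sqrt (((1 + B) / (2 * H))\<^sup>2 - z\<^sup>2))\<^sup>2"
      using y by (intro power_strict_mono) auto
    then have "y\<^sup>2 + z\<^sup>2 \<le> ((1 + B) / (2 * H))\<^sup>2"
      using z2 by simp
    then have upper: "(2 * H)\<^sup>2 * (y\<^sup>2 + z\<^sup>2) \<le> (1 + B)\<^sup>2"
      using H by (simp add: power_divide field_simps)
    have "(\<bar>1 - B\<bar> / (2 * H))\<^sup>2 \<le> z\<^sup>2"
      using z H by (intro power_mono) auto
    also have "\<dots> \<le> y\<^sup>2 + z\<^sup>2"
      by simp
    finally have lower: "(1 - B)\<^sup>2 \<le> (2 * H)\<^sup>2 * (y\<^sup>2 + z\<^sup>2)"
      using H by (simp add: power_divide field_simps)
    have "{x. vector [x, y, z] \<in> ?S} \<subseteq> {x. poly3_eval P (vector [x, y, z]) = 0}"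
      using P(2) unfolding zero_set_def by blast
    then show "infinite {x. poly3_eval P (vector [x, y, z]) = 0}"
      using line_meets_surface_infinitely_often[OF H B z0 lower upper] by (rule infinite_super)
  qed
  with P(1) show False
    by contradiction
qed

end
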